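(* Let $P,Q,b_0\in\mathbb C$ and let $x,y,z:\mathbb Z^2\to\mathbb C$ satisfy the B2 lattice system at every lattice point, with $x_{1,0}\neq x_{0,1}$ at every lattice point: $$y_{1,0}+z_{0,0}=x_{0,0}x_{1,0},\qquad y_{0,1}+z_{0,0}=x_{0,0}x_{0,1},$$ $$y_{0,0}+z_{1,1}=x_{0,0}x_{1,1}+b_0(x_{1,1}-x_{0,0})+\frac{P-Q}{x_{1,0}-x_{0,1}} .$$ Put $w:=y+z$. Then $(x,w)$ satisfies, at every lattice point, the two-component quadrilateral system $$w_{0,1}-w_{1,0}-(x_{0,0}+x_{1,1})(x_{0,1}-x_{1,0})=0,$$ $$\frac{P-Q-x_{1,0}w_{1,0}+x_{0,1}w_{0,1}}{x_{1,0}-x_{0,1}}-w_{0,0}-w_{1,1}+b_0(x_{1,1}-x_{0,0})+(x_{0,0}+x_{1,1})(x_{1,0}+x_{0,1})+x_{0,0}x_{1,1}=0 .$$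
   Context: For a function $u$ on $\mathbb Z^2$ and a generic base point $(n,m)$, $u_{\nu,\mu}$ denotes $u(n+\nu,m+\mu)$; an equation "holds at every lattice point" if it holds for every $(n,m)\in\mathbb Z^2$. *)

theory Defs
  imports Complex_Main
begin

text \<open>
  Functions on the lattice are curried: \<open>u n m\<close> is the value at \<open>(n, m)\<close>, so that
  \<open>u\<^sub>\<nu>\<^sub>,\<^sub>\<mu>\<close> is \<open>u (n + \<nu>) (m + \<mu>)\<close>.
\<close>

definition B2_lattice_at ::
  "complex \<Rightarrow> complex \<Rightarrow> complex \<Rightarrow> (int \<Rightarrow> int \<Rightarrow> complex) \<Rightarrow> (int \<Rightarrow> int \<Rightarrow> complex) \<Rightarrow>
    (int \<Rightarrow> int \<Rightarrow> complex) \<Rightarrow> int \<Rightarrow> int \<Rightarrow> bool" where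
  "B2_lattice_at P Q b0 x y z n m \<longleftrightarrow>
     y (n+1) m + z n m = x n m * x (n+1) m \<and>
     y n (m+1) + z n m = x n m * x n (m+1) \<and>
     y n m + z (n+1) (m+1) =
       x n m * x (n+1) (m+1) + b0 * (x (n+1) (m+1) - x n m)
         + (P - Q) / (x (n+1) m - x n (m+1))"

definition two_component_quad_at ::
  "complex \<Rightarrow> complex \<Rightarrow> complex \<Rightarrow> (int \<Rightarrow> int \<Rightarrow> complex) \<Rightarrow> (int \<Rightarrow> int \<Rightarrow> complex) \<Rightarrow>
    int \<Rightarrow> int \<Rightarrow> bool" where
  "two_component_quad_at P Q b0 x w n m \<longleftrightarrow>
     w n (m+1) - w (n+1) m - (x n m + x (n+1) (m+1)) * (x n (m+1) - x (n+1) m) = 0 \<and>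
     (P - Q - x (n+1) m * w (n+1) m + x n (m+1) * w n (m+1)) / (x (n+1) m - x n (m+1))
       - w n m - w (n+1) (m+1)
       + b0 * (x (n+1) (m+1) - x n m)
       + (x n m + x (n+1) (m+1)) * (x (n+1) m + x n (m+1))
       + x n m * x (n+1) (m+1) = 0"

end

theory Submission
  imports Defs
begin

theorem mainTheorem2:
  fixes P Q b0 :: complex
    and x y z w :: "int \<Rightarrow> int \<Rightarrow> complex"
  assumes B2: "\<And>n m. B2_lattice_at P Q b0 x y z n m"
    and nondegenerate: "\<And>n m. x (n+1) m \<noteq> x n (m+1)"
    and w: "w = (\<lambda>n m. y n m + z n m)"
  shows "\<forall>n m. two_component_quad_at P Q b0 x w n m"
proof (intro allI)
  fix n m
  define X a b c where vars: "X = x n m" "a = x (n+1) m" "b = x n (m+1)" "c = x (n+1) (m+1)"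
  define s where "s = z n m + y (n+1) (m+1)"
  have ab: "a - b \<noteq> 0"
    using nondegenerate[of n m] by (simp add: vars)
  \<comment> \<open>The shifted equations express \<open>z\<^sub>1\<^sub>,\<^sub>0\<close> and \<open>z\<^sub>0\<^sub>,\<^sub>1\<close> through \<open>y\<^sub>1\<^sub>,\<^sub>1\<close>, so that
    \<open>w\<^sub>1\<^sub>,\<^sub>0\<close> and \<open>w\<^sub>0\<^sub>,\<^sub>1\<close> involve \<open>y\<close> and \<open>z\<close> only through the common term \<open>s\<close>.\<close>
  have "y (n+1) m + z n m = X * a" "y (n+1) (m+1) + z (n+1) m = a * c"
    using B2[of n m] B2[of "n+1" m] by (simp_all add: B2_lattice_at_def vars)
  then have w10: "w (n+1) m = (X + c) * a - s"
    unfolding w s_def by algebra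
  have "y n (m+1) + z n m = X * b" "y (n+1) (m+1) + z n (m+1) = b * c"
    using B2[of n m] B2[of n "m+1"] by (simp_all add: B2_lattice_at_def vars)
  then have w01: "w n (m+1) = (X + c) * b - s"
    unfolding w s_def by algebra
  have diag: "y n m + z (n+1) (m+1) = X * c + b0 * (c - X) + (P - Q) / (a - b)"
    using B2[of n m] by (simp add: B2_lattice_at_def vars)
  \<comment> \<open>The terms in \<open>X + c\<close> combine to the difference of squares
    \<open>a^2 - b^2\<close>, so everything except \<open>P - Q\<close> is divisible by
    \<open>a - b\<close>.\<close>
  have num: "P - Q - a * w (n+1) m + b * w n (m+1) = (P - Q) + (s - (X + c) * (a + b)) * (a - b)"
    unfolding w10 w01 by (simp add: algebra_simps)
  have quot: "(P - Q - a * w (n+1) m + b * w n (m+1)) / (a - b)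
      = (P - Q) / (a - b) + s - (X + c) * (a + b)"
    using ab unfolding num add_divide_distrib by simp
  have "w n (m+1) - w (n+1) m - (X + c) * (b - a) = 0"
    unfolding w10 w01 by (simp add: algebra_simps)
  \<comment> \<open>Regrouping gives
    \<open>w n m + w (n+1) (m+1) = s + (y n m + z (n+1) (m+1))\<close>: here \<open>s\<close>
    cancels against the quotient, and \<open>diag\<close> evaluates the bracket.\<close>
  moreover have "(P - Q - a * w (n+1) m + b * w n (m+1)) / (a - b) - w n m - w (n+1) (m+1)
      + b0 * (c - X) + (X + c) * (a + b) + X * c = 0"
    using diag unfolding quot unfolding w s_def by algebra
  ultimately show "two_component_quad_at P Q b0 x w n m"
    by (simp only: two_component_quad_at_def vars simp_thms)
qed

end
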